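(* With the notation of the context, assume $\tilde c=0$ and $\lambda>\tilde\lambda$. Then $$\lim_{c\to0^+}\bar x_1(c)=\lim_{c\to0^+}x_1^*(c)=\tilde s-\zeta<\tilde s+\zeta=\lim_{c\to0^+}x_2^*(c)=\lim_{c\to0^+}\bar x_2(c),$$ where $$\zeta=\frac1\theta\log\left(\sqrt{\frac{\lambda-\tilde\lambda}{2\eta}+1}+\sqrt{\frac{\lambda-\tilde\lambda}{2\eta}}\right)>0.$$
   Context: Fix $\rho,\sigma>0$, $\tilde c\ge0$, $\lambda\ge\tilde\lambda\ge0$ with $1-\lambda\rho>0$, and $\tilde s\in\mathbb{R}$; the parameter $c$ varies in $]\tilde c,\infty[$. Set $\theta=\sqrt{2\rho/\sigma^2}$ and $\eta=(1-\lambda\rho)/\rho>0$. For $c>0$ let $\xi(c)$ be the unique zero in $(0,\eta)$ of $F(x)=2x+\theta c-\eta\log\frac{\eta+x}{\eta-x}$, and let $$\Gamma(c)=\frac{\theta(c-\tilde c)}{4\xi(c)}+\frac{\theta c(\lambda-\tilde\lambda)}{4\eta\xi(c)}+\frac{\lambda-\tilde\lambda}{2\eta}.$$ For $i\in\{1,2\}$ set (writing $\xi=\xi(c)$, $\Gamma=\Gamma(c)$) $$\bar x_i(c)=\tilde s+\frac{(-1)^i}{\theta}\log\Big[\sqrt{\tfrac{\eta+\xi}{\eta-\xi}}\big(\sqrt{\Gamma+1}+\sqrt\Gamma\big)\Big],\qquad x_i^*(c)=\tilde s+\frac{(-1)^i}{\theta}\log\Big[\sqrt{\tfrac{\eta-\xi}{\eta+\xi}}\big(\sqrt{\Gamma+1}+\sqrt\Gamma\big)\Big].$$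 These are the intervention thresholds $\bar x_i$ and target states $x_i^*$ of player $i$ at the Nash equilibrium of index $\tilde s$ in an impulse game on a scaled Brownian motion $\sigma W$ with linear running payoffs, discount rate $\rho$, intervention cost $c+\lambda|\delta|$ and gain $\tilde c+\tilde\lambda|\delta|$ for the opponent. *)

theory Defs
  imports Complex_Main
begin

definition theta :: "real \<Rightarrow> real \<Rightarrow> real" where
  "theta \<rho> \<sigma> = sqrt (2 * \<rho> / \<sigma>\<^sup>2)"

definition eta :: "real \<Rightarrow> real \<Rightarrow> real" where
  "eta \<rho> lam = (1 - lam * \<rho>) / \<rho>"

definition F :: "real \<Rightarrow> real \<Rightarrow> real \<Rightarrow> real \<Rightarrow> real \<Rightarrow> real" where
  "F \<rho> \<sigma> lam c x =
     2 * x + theta \<rho> \<sigma> * c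
       - eta \<rho> lam * ln ((eta \<rho> lam + x) / (eta \<rho> lam - x))"

text \<open>For \<open>c > 0\<close> the zero below exists and is unique: on \<open>(0, \<eta>)\<close> the function \<open>F\<close> is
  strictly decreasing, from \<open>\<theta> c > 0\<close> to minus infinity. For \<open>c \<le> 0\<close> there is no such zero
  and the value of \<open>xi\<close> is meaningless.\<close>

definition xi :: "real \<Rightarrow> real \<Rightarrow> real \<Rightarrow> real \<Rightarrow> real" where
  "xi \<rho> \<sigma> lam c = (THE x. 0 < x \<and> x < eta \<rho> lam \<and> F \<rho> \<sigma> lam c x = 0)"

text \<open>\<open>lam\<close> is lambda. In the following, \<open>c'\<close>, \<open>lam'\<close> and \<open>s'\<close> stand for the parameters written with a tilde
  (fixed and proportional gain of the opponent, index of the equilibrium).\<close>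

definition Gam :: "real \<Rightarrow> real \<Rightarrow> real \<Rightarrow> real \<Rightarrow> real \<Rightarrow> real \<Rightarrow> real" where
  "Gam \<rho> \<sigma> c' lam lam' c =
     theta \<rho> \<sigma> * (c - c') / (4 * xi \<rho> \<sigma> lam c)
     + theta \<rho> \<sigma> * c * (lam - lam') / (4 * eta \<rho> lam * xi \<rho> \<sigma> lam c)
     + (lam - lam') / (2 * eta \<rho> lam)"

definition xbar ::
  "real \<Rightarrow> real \<Rightarrow> real \<Rightarrow> real \<Rightarrow> real \<Rightarrow> real \<Rightarrow> nat \<Rightarrow> real \<Rightarrow> real" where
  "xbar \<rho> \<sigma> c' lam lam' s' i c =
     s' + (-1) ^ i / theta \<rho> \<sigma> *
       ln (sqrt ((eta \<rho> lam + xi \<rho> \<sigma> lam c) / (eta \<rho> lam - xi \<rho> \<sigma> lam c))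
           * (sqrt (Gam \<rho> \<sigma> c' lam lam' c + 1) + sqrt (Gam \<rho> \<sigma> c' lam lam' c)))"

definition xstar ::
  "real \<Rightarrow> real \<Rightarrow> real \<Rightarrow> real \<Rightarrow> real \<Rightarrow> real \<Rightarrow> nat \<Rightarrow> real \<Rightarrow> real" where
  "xstar \<rho> \<sigma> c' lam lam' s' i c =
     s' + (-1) ^ i / theta \<rho> \<sigma> *
       ln (sqrt ((eta \<rho> lam - xi \<rho> \<sigma> lam c) / (eta \<rho> lam + xi \<rho> \<sigma> lam c))
           * (sqrt (Gam \<rho> \<sigma> c' lam lam' c + 1) + sqrt (Gam \<rho> \<sigma> c' lam lam' c)))"

definition zeta :: "real \<Rightarrow> real \<Rightarrow> real \<Rightarrow> real \<Rightarrow> real" where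
  "zeta \<rho> \<sigma> lam lam' =
     1 / theta \<rho> \<sigma> *
       ln (sqrt ((lam - lam') / (2 * eta \<rho> lam) + 1) + sqrt ((lam - lam') / (2 * eta \<rho> lam)))"

end

theory Submission
  imports Defs
begin

text \<open>
  Write the equation \<open>F(x) = 0\<close> as \<open>G(x) = \<theta> c\<close> with \<open>G(x) = \<eta> log ((\<eta> + x) / (\<eta> - x)) - 2 x\<close>.
  The function \<open>G\<close> vanishes at \<open>0\<close> and has derivative \<open>2 x\<^sup>2 / (\<eta>\<^sup>2 - x\<^sup>2)\<close>, so it is strictly
  increasing on \<open>[0, \<eta>)\<close> and flat at the origin. Monotonicity squeezes the zero \<open>\<xi>(c)\<close> to \<open>0\<close> as
  \<open>c \<rightarrow> 0\<close>; flatness gives \<open>\<theta> c / \<xi>(c) = G(\<xi>(c)) / \<xi>(c) \<rightarrow> G'(0) = 0\<close>, i.e. \<open>c\<close> is negligible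
  with respect to \<open>\<xi>(c)\<close>.

  When \<open>c' = 0\<close>, the two terms of \<open>\<Gamma>(c)\<close> that depend on \<open>c\<close> are constant multiples of
  \<open>\<theta> c / \<xi>(c)\<close>, so \<open>\<Gamma>(c) \<rightarrow> (\<lambda> - \<lambda>') / (2 \<eta>)\<close>. The factors \<open>sqrt ((\<eta> \<plusminus> \<xi>) / (\<eta> \<mp> \<xi>))\<close>, which
  are all that separates a threshold from its target, tend to \<open>1\<close>. By continuity every threshold
  and every target of player \<open>i\<close> tends to \<open>s' + (-1)\<^sup>i \<zeta>\<close>.
\<close>

text \<open>The function \<open>G\<close> above: the excess of the logarithmic term of \<open>F\<close> over its linear term,
  which a zero of \<open>F\<close> must balance against \<open>\<theta> c\<close>.\<close>

definition excess :: "real \<Rightarrow> real \<Rightarrow> real" where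
  "excess e x = e * ln ((e + x) / (e - x)) - 2 * x"

lemma F_eq_excess: "F \<rho> \<sigma> lam c x = theta \<rho> \<sigma> * c - excess (eta \<rho> lam) x"
  by (simp add: F_def excess_def)

lemma excess_0 [simp]: "excess e 0 = 0"
  by (cases "e = 0") (simp_all add: excess_def)

lemma excess_has_derivative:
  assumes "\<bar>x\<bar> < e"
  shows "(excess e has_real_derivative 2 * x\<^sup>2 / (e\<^sup>2 - x\<^sup>2)) (at x)"
proof -
  have pos: "e + x > 0" "e - x > 0"
    using assms by auto
  have fac: "e\<^sup>2 - x\<^sup>2 = (e + x) * (e - x)"
    by (simp add: power2_eq_square algebra_simps)
  have "((\<lambda>x. e * ln ((e + x) / (e - x)) - 2 * x) has_real_derivative
      e * (((e - x) + (e + x)) / ((e - x) * (e - x)) / ((e + x) / (e - x))) - 2) (at x)"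
    using pos by (auto intro!: derivative_eq_intros simp: mult_ac)
  moreover have "e * (((e - x) + (e + x)) / ((e - x) * (e - x)) / ((e + x) / (e - x))) - 2
      = 2 * x\<^sup>2 / (e\<^sup>2 - x\<^sup>2)"
  proof -
    have quot: "e * ((q + p) / (q * q) / (p / q)) - 2 = (e * (q + p) - 2 * (p * q)) / (p * q)"
      if "p > 0" "q > 0" for p q :: real
      using that by (simp add: field_simps)
    have "e * (((e - x) + (e + x)) / ((e - x) * (e - x)) / ((e + x) / (e - x))) - 2
        = (e * ((e - x) + (e + x)) - 2 * ((e + x) * (e - x))) / ((e + x) * (e - x))"
      by (rule quot[OF pos])
    also have "e * ((e - x) + (e + x)) - 2 * ((e + x) * (e - x)) = 2 * x\<^sup>2"
      by (simp add: power2_eq_square algebra_simps)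
    finally show ?thesis
      by (simp only: fac)
  qed
  ultimately show ?thesis
    by (simp add: excess_def[abs_def])
qed

text \<open>The derivative vanishes at the left end \<open>x = 0\<close> of the range, but only there, so
  monotonicity is still strict up to this end.\<close>

lemma excess_strict_mono:
  assumes "0 \<le> x" "x < y" "y < e"
  shows "excess e x < excess e y"
proof (rule DERIV_pos_imp_increasing_open[OF \<open>x < y\<close>])
  fix t assume "x < t" "t < y"
  then have "\<bar>t\<bar> < e" "t \<noteq> 0" "t\<^sup>2 < e\<^sup>2"
    using assms by (auto intro: power_strict_mono)
  then show "\<exists>d. (excess e has_real_derivative d) (at t) \<and> d > 0"
    by (intro exI[of _ "2 * t\<^sup>2 / (e\<^sup>2 - t\<^sup>2)"] conjI excess_has_derivative) auto
next
  show "continuous_on {x..y} (excess e)"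
    using assms
    by (intro continuous_at_imp_continuous_on ballI DERIV_isCont[OF excess_has_derivative]) auto
qed

lemma excess_quotient_tendsto_0:
  assumes "e > 0"
  shows "((\<lambda>x. excess e x / x) \<longlongrightarrow> 0) (at_right 0)"
proof -
  have "(excess e has_real_derivative 0) (at 0)"
    using excess_has_derivative[of 0 e] assms by simp
  then have "((\<lambda>x. excess e x / x) \<longlongrightarrow> 0) (at 0)"
    by (simp add: has_field_derivative_iff)
  then show ?thesis
    by (rule filterlim_mono) (simp_all add: at_le)
qed

lemma xi_eqI:
  assumes "0 < x" "x < eta \<rho> lam" "excess (eta \<rho> lam) x = theta \<rho> \<sigma> * c"
  shows "xi \<rho> \<sigma> lam c = x"
  unfolding xi_def
proof (rule the_equality)
  show "0 < x \<and> x < eta \<rho> lam \<and> F \<rho> \<sigma> lam c x = 0"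
    using assms by (simp add: F_eq_excess)
next
  fix y assume y: "0 < y \<and> y < eta \<rho> lam \<and> F \<rho> \<sigma> lam c y = 0"
  then have "excess (eta \<rho> lam) y = excess (eta \<rho> lam) x"
    using assms by (simp add: F_eq_excess)
  then show "y = x"
    using excess_strict_mono[of x y "eta \<rho> lam"] excess_strict_mono[of y x "eta \<rho> lam"] y assms
    by (cases x y rule: linorder_cases) auto
qed

text \<open>Only small \<open>c\<close> matter: once \<open>\<theta> c\<close> is below the value of the increasing function at \<open>d\<close>, the
  intermediate value theorem on \<open>[0, d]\<close> already provides the zero, and places it below \<open>d\<close>.\<close>

lemma eventually_xi:
  assumes "theta \<rho> \<sigma> > 0" "0 < d" "d < eta \<rho> lam"
  shows "eventually (\<lambda>c. 0 < xi \<rho> \<sigma> lam c \<and> xi \<rho> \<sigma> lam c < d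
           \<and> excess (eta \<rho> lam) (xi \<rho> \<sigma> lam c) = theta \<rho> \<sigma> * c) (at_right 0)"
proof -
  let ?e = "eta \<rho> lam" and ?t = "theta \<rho> \<sigma>"
  have "excess ?e d > 0"
    using excess_strict_mono[of 0 d ?e] assms by simp
  then have "excess ?e d / ?t > 0"
    using assms by simp
  then have "eventually (\<lambda>c. 0 < c \<and> c < excess ?e d / ?t) (at_right 0)"
    unfolding eventually_at_right_field by (intro exI[of _ "excess ?e d / ?t"]) auto
  then show ?thesis
  proof eventually_elim
    case (elim c)
    then have tc: "0 < ?t * c" "?t * c < excess ?e d"
      using assms by (simp_all add: pos_less_divide_eq mult.commute)
    have "\<forall>x. 0 \<le> x \<and> x \<le> d \<longrightarrow> isCont (excess ?e) x"
      using assms by (auto intro!: DERIV_isCont[OF excess_has_derivative])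
    then obtain x where x: "0 \<le> x" "x \<le> d" "excess ?e x = ?t * c"
      using IVT[of "excess ?e" 0 "?t * c" d] tc assms by auto
    then have "x \<noteq> 0" "x \<noteq> d"
      using tc by auto
    then show ?case
      using xi_eqI[of x \<rho> lam \<sigma> c] x assms by auto
  qed
qed

lemma xi_at_right_0:
  assumes "theta \<rho> \<sigma> > 0" "eta \<rho> lam > 0"
  shows "filterlim (xi \<rho> \<sigma> lam) (at_right 0) (at_right 0)"
  unfolding filterlim_at
proof
  have half: "0 < eta \<rho> lam / 2" "eta \<rho> lam / 2 < eta \<rho> lam"
    using assms by auto
  show "eventually (\<lambda>c. xi \<rho> \<sigma> lam c \<in> {0<..} \<and> xi \<rho> \<sigma> lam c \<noteq> 0) (at_right 0)"
    using eventually_xi[OF assms(1) half] by eventually_elim auto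
  show "(xi \<rho> \<sigma> lam \<longlongrightarrow> 0) (at_right 0)"
    unfolding tendsto_iff
  proof (intro allI impI)
    fix r :: real assume "r > 0"
    then have "0 < min r (eta \<rho> lam / 2)" "min r (eta \<rho> lam / 2) < eta \<rho> lam"
      using half by auto
    from eventually_xi[OF assms(1) this]
    show "eventually (\<lambda>c. dist (xi \<rho> \<sigma> lam c) 0 < r) (at_right 0)"
      by eventually_elim auto
  qed
qed

lemma cost_over_xi_tendsto_0:
  assumes "theta \<rho> \<sigma> > 0" "eta \<rho> lam > 0"
  shows "((\<lambda>c. theta \<rho> \<sigma> * c / xi \<rho> \<sigma> lam c) \<longlongrightarrow> 0) (at_right 0)"
proof -
  have "((\<lambda>c. excess (eta \<rho> lam) (xi \<rho> \<sigma> lam c) / xi \<rho> \<sigma> lam c) \<longlongrightarrow> 0) (at_right 0)"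
    by (rule filterlim_compose[OF excess_quotient_tendsto_0 xi_at_right_0]) (use assms in auto)
  moreover have "eventually (\<lambda>c. excess (eta \<rho> lam) (xi \<rho> \<sigma> lam c) / xi \<rho> \<sigma> lam c
      = theta \<rho> \<sigma> * c / xi \<rho> \<sigma> lam c) (at_right 0)"
    using eventually_xi[OF assms(1), of "eta \<rho> lam / 2" lam] assms
    by (auto elim!: eventually_mono)
  ultimately show ?thesis
    by (rule Lim_transform_eventually)
qed

lemma Gam_tendsto:
  assumes "theta \<rho> \<sigma> > 0" "eta \<rho> lam > 0"
  shows "(Gam \<rho> \<sigma> 0 lam lam' \<longlongrightarrow> (lam - lam') / (2 * eta \<rho> lam)) (at_right 0)"
proof -
  let ?q = "\<lambda>c. theta \<rho> \<sigma> * c / xi \<rho> \<sigma> lam c" and ?g = "(lam - lam') / (2 * eta \<rho> lam)"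
  have "((\<lambda>c. ?q c * (1 / 4) + ?q c * ((lam - lam') / (4 * eta \<rho> lam)) + ?g)
      \<longlongrightarrow> 0 * (1 / 4) + 0 * ((lam - lam') / (4 * eta \<rho> lam)) + ?g) (at_right 0)"
    by (intro tendsto_intros cost_over_xi_tendsto_0 assms)
  moreover have "Gam \<rho> \<sigma> 0 lam lam'
      = (\<lambda>c. ?q c * (1 / 4) + ?q c * ((lam - lam') / (4 * eta \<rho> lam)) + ?g)"
    by (rule ext) (simp add: Gam_def mult_ac)
  ultimately show ?thesis
    by simp
qed

lemma sqrt_sum_gt_1: "1 < sqrt (g + 1) + sqrt g" if "g > 0" for g :: real
  using that real_sqrt_gt_zero[of g] real_sqrt_gt_1_iff[of "g + 1"] by linarith

lemma xbar_xstar_tendsto: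
  assumes "theta \<rho> \<sigma> > 0" "eta \<rho> lam > 0" "lam > lam'"
  shows "(xbar \<rho> \<sigma> 0 lam lam' s' i \<longlongrightarrow> s' + (-1) ^ i * zeta \<rho> \<sigma> lam lam') (at_right 0)"
    and "(xstar \<rho> \<sigma> 0 lam lam' s' i \<longlongrightarrow> s' + (-1) ^ i * zeta \<rho> \<sigma> lam lam') (at_right 0)"
proof -
  let ?e = "eta \<rho> lam" and ?x = "xi \<rho> \<sigma> lam" and ?G = "Gam \<rho> \<sigma> 0 lam lam'"
    and ?g = "(lam - lam') / (2 * eta \<rho> lam)"
  have x: "(?x \<longlongrightarrow> 0) (at_right 0)"
    using xi_at_right_0[OF assms(1,2)] by (simp add: filterlim_at)
  have "?g > 0"
    using assms by simp
  note g = sqrt_sum_gt_1[OF this]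
  \<comment> \<open>The quotients \<open>(\<eta> \<plusminus> 0) / (\<eta> \<mp> 0)\<close> keep the shape that the continuity rules produce.\<close>
  have "(xbar \<rho> \<sigma> 0 lam lam' s' i \<longlongrightarrow> s' + (-1) ^ i / theta \<rho> \<sigma> *
      ln (sqrt ((?e + 0) / (?e - 0)) * (sqrt (?g + 1) + sqrt ?g))) (at_right 0)"
    unfolding xbar_def[abs_def]
    using assms g by (intro tendsto_intros x Gam_tendsto) auto
  then show "(xbar \<rho> \<sigma> 0 lam lam' s' i \<longlongrightarrow> s' + (-1) ^ i * zeta \<rho> \<sigma> lam lam') (at_right 0)"
    using assms by (simp add: zeta_def)
  have "(xstar \<rho> \<sigma> 0 lam lam' s' i \<longlongrightarrow> s' + (-1) ^ i / theta \<rho> \<sigma> *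
      ln (sqrt ((?e - 0) / (?e + 0)) * (sqrt (?g + 1) + sqrt ?g))) (at_right 0)"
    unfolding xstar_def[abs_def]
    using assms g by (intro tendsto_intros x Gam_tendsto) auto
  then show "(xstar \<rho> \<sigma> 0 lam lam' s' i \<longlongrightarrow> s' + (-1) ^ i * zeta \<rho> \<sigma> lam lam') (at_right 0)"
    using assms by (simp add: zeta_def)
qed

theorem proposition4p11:
  fixes \<rho> \<sigma> c' lam lam' s' :: real
  assumes "\<rho> > 0" and "\<sigma> > 0"
    and "lam' \<ge> 0" and "1 - lam * \<rho> > 0"
    and "c' = 0" and "lam > lam'"
  shows "(xbar \<rho> \<sigma> c' lam lam' s' 1 \<longlongrightarrow> s' - zeta \<rho> \<sigma> lam lam') (at_right 0)
    \<and> (xstar \<rho> \<sigma> c' lam lam' s' 1 \<longlongrightarrow> s' - zeta \<rho> \<sigma> lam lam') (at_right 0)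
    \<and> s' - zeta \<rho> \<sigma> lam lam' < s' + zeta \<rho> \<sigma> lam lam'
    \<and> (xstar \<rho> \<sigma> c' lam lam' s' 2 \<longlongrightarrow> s' + zeta \<rho> \<sigma> lam lam') (at_right 0)
    \<and> (xbar \<rho> \<sigma> c' lam lam' s' 2 \<longlongrightarrow> s' + zeta \<rho> \<sigma> lam lam') (at_right 0)
    \<and> zeta \<rho> \<sigma> lam lam' > 0"
proof -
  have t: "theta \<rho> \<sigma> > 0" and e: "eta \<rho> lam > 0"
    using assms by (simp_all add: theta_def eta_def)
  have "(lam - lam') / (2 * eta \<rho> lam) > 0"
    using assms e by simp
  then have "zeta \<rho> \<sigma> lam lam' > 0"
    unfolding zeta_def using t by (intro mult_pos_pos ln_gt_zero sqrt_sum_gt_1) auto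
  then show ?thesis
    using xbar_xstar_tendsto[OF t e \<open>lam > lam'\<close>, of s' 1]
      xbar_xstar_tendsto[OF t e \<open>lam > lam'\<close>, of s' 2] \<open>c' = 0\<close> by simp
qed

end
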